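(* Let $f\in Z^2(G,S^* )$ and let $r_f\in Sl(G)$ be the function $r_f(\sigma)=v_\pi(f(\sigma,\sigma^{-1}))$. For $\sigma,\tau\in G$ let $c(\sigma,\tau)\in U(S)$ be the unit determined by $f(\sigma,\tau)=c(\sigma,\tau)\pi^{v_\pi(f(\sigma,\tau))}$. Then the function $h:G\times G\to S^*$ defined by $$h(\sigma,\tau)=[c(\sigma,\tau)c(\tau^{-1},\sigma^{-1})]^{-1}u(\sigma)^{r_f(\tau)}f(\tau^{-1},\sigma^{-1}),\qquad \sigma,\tau\in G,$$ is an element of $Z^2(G,S^* )$ such that $fh=b_{r_f}$.
   Context: Standing assumptions: $R$ is a complete discrete valuation ring with quotient field $K$, $L$ is a finite Galois extension of $K$ with Galois group $G$, unramified with finite residue field; $S$ is the integral closure of $R$ in $L$, $\pi S$ its unique maximal ideal (with $\pi$ a fixed generator), $S^*=S\setminus\{0\}$, and $U(S)$ the group of units of $S$. $v_\pi$ is the $\pi S$-adic valuation. The function $u:G\to U(S)$ is defined by $\sigma(\pi)=u(\sigma)\pi$. For $\sigma\in G$ and $l\in L$ write $l^\sigma=\sigma(l)$. $Z^2(G,S^* )$ is the set of normalized weak $2$-cocycles of $G$ on $S^*$, i.e. functions $f:G\times G\to S^*$ with $f(\sigma,\tau)f(\sigma\tau,\rho)=f(\tau,\rho)^{\sigma}f(\sigma,\tau\rho)$ for all $\sigma,\tau,\rho\in G$ and $f(1,\sigma)=f(\sigma,1)=1$ for all $\sigma\in G$. Products of cocycles are pointwise. $Sl(G)$ is the set of all functions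 $r:G\to\mathbb{N}$ (with $0\in\mathbb{N}$) satisfying $r(1)=0$ and $r(\sigma\tau)\leq r(\sigma)+r(\tau)$ for all $\sigma,\tau\in G$. For every $f\in Z^2(G,S^* )$ the function $r_f$ belongs to $Sl(G)$. For $r\in Sl(G)$, $b_r:G\times G\to S^*$ is defined by $b_r(\sigma,\tau)=u(\sigma)^{r(\tau)}\pi^{r(\sigma)+r(\tau)-r(\sigma\tau)}$. *)

theory Defs
  imports "HOL-Algebra.Algebra"
begin

text \<open>
  All rings are subrings of an ambient field \<open>L\<close>: a subring with underlying set \<open>A\<close> is
  the record \<open>L\<lparr>carrier := A\<rparr>\<close>.
\<close>

section \<open>Complete discrete valuation rings and adic valuations\<close>

text \<open>Meaningful for local rings only.\<close>

definition max_ideal :: "('a, 'b) ring_scheme \<Rightarrow> 'a set" where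
  "max_ideal A = (THE M. maximalideal M A)"

definition residue_field :: "('a, 'b) ring_scheme \<Rightarrow> 'a set ring" where
  "residue_field A = A Quot (max_ideal A)"

definition discrete_valuation_ring :: "('a, 'b) ring_scheme \<Rightarrow> bool" where
  "discrete_valuation_ring A \<longleftrightarrow>
     principal_domain A \<and> (\<exists>!P. primeideal P A \<and> P \<noteq> {\<zero>\<^bsub>A\<^esub>})"

text \<open>The \<open>n\<close>-th power is taken in the library's monoid of ideals, so \<open>I\<^sup>0 = A\<close>.\<close>

definition ideal_power :: "('a, 'b) ring_scheme \<Rightarrow> 'a set \<Rightarrow> nat \<Rightarrow> 'a set" where
  "ideal_power A I n = I [^]\<^bsub>ideals_set A\<^esub> n"

definition adic_cauchy :: "('a, 'b) ring_scheme \<Rightarrow> 'a set \<Rightarrow> (nat \<Rightarrow> 'a) \<Rightarrow> bool" where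
  "adic_cauchy A I s \<longleftrightarrow>
     (\<forall>n. \<exists>N. \<forall>i\<ge>N. \<forall>j\<ge>N. s i \<ominus>\<^bsub>A\<^esub> s j \<in> ideal_power A I n)"

definition adic_converges :: "('a, 'b) ring_scheme \<Rightarrow> 'a set \<Rightarrow> (nat \<Rightarrow> 'a) \<Rightarrow> 'a \<Rightarrow> bool" where
  "adic_converges A I s x \<longleftrightarrow>
     (\<forall>n. \<exists>N. \<forall>i\<ge>N. s i \<ominus>\<^bsub>A\<^esub> x \<in> ideal_power A I n)"

definition complete_dvr :: "('a, 'b) ring_scheme \<Rightarrow> bool" where
  "complete_dvr A \<longleftrightarrow> discrete_valuation_ring A \<and>
     (\<forall>s. range s \<subseteq> carrier A \<and> adic_cauchy A (max_ideal A) s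
        \<longrightarrow> (\<exists>x\<in>carrier A. adic_converges A (max_ideal A) s x))"

text \<open>
  The \<open>I\<close>-adic valuation of a nonzero element of \<open>A\<close>. The value at \<open>\<zero>\<close> (mathematically
  \<open>\<infinity>\<close>) is unspecified; the cocycles below have nonzero values.
\<close>

definition adic_val :: "('a, 'b) ring_scheme \<Rightarrow> 'a set \<Rightarrow> 'a \<Rightarrow> nat" where
  "adic_val A I x = (GREATEST n. x \<in> ideal_power A I n)"


section \<open>Extensions\<close>

definition quotient_field :: "('a, 'b) ring_scheme \<Rightarrow> 'a set \<Rightarrow> 'a set \<Rightarrow> bool" where
  "quotient_field L R K \<longleftrightarrow> subring R L \<and> subfield K L \<and>
     K = {a \<otimes>\<^bsub>L\<^esub> inv\<^bsub>L\<^esub> b | a b. a \<in> R \<and> b \<in> R - {\<zero>\<^bsub>L\<^esub>}}"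

text \<open>
  Library polynomials are coefficient lists, leading coefficient first, so monic means that the
  list is nonempty with head \<open>\<one>\<close>.
\<close>

definition integral_closure :: "('a, 'b) ring_scheme \<Rightarrow> 'a set \<Rightarrow> 'a set" where
  "integral_closure L R =
     {x \<in> carrier L. \<exists>p \<in> carrier (univ_poly L R).
        p \<noteq> [] \<and> hd p = \<one>\<^bsub>L\<^esub> \<and> ring.eval L p x = \<zero>\<^bsub>L\<^esub>}"

text \<open>
  Automorphisms are extensional, as in \<^const>\<open>BijGroup\<close>, so that they are determined by
  their restriction to \<open>carrier L\<close>.
\<close>

definition galois_group :: "('a, 'b) ring_scheme \<Rightarrow> 'a set \<Rightarrow> ('a \<Rightarrow> 'a) monoid" where
  "galois_group L K = BijGroup (carrier L)
     \<lparr>carrier := {\<sigma> \<in> ring_iso L L \<inter> extensional (carrier L). \<forall>x\<in>K. \<sigma> x = x}\<rparr>"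

definition finite_galois :: "('a, 'b) ring_scheme \<Rightarrow> 'a set \<Rightarrow> bool" where
  "finite_galois L K \<longleftrightarrow> subfield K L \<and> ring.finite_dimension L K (carrier L) \<and>
     {x \<in> carrier L. \<forall>\<sigma>\<in>carrier (galois_group L K). \<sigma> x = x} = K"

text \<open>
  An algebraic element is separable over the subfield \<open>F\<close> iff it is a simple root of its
  minimal polynomial.
\<close>

definition separable_extension :: "('a, 'b) ring_scheme \<Rightarrow> 'a set \<Rightarrow> bool" where
  "separable_extension E F \<longleftrightarrow> (\<forall>x\<in>carrier E.
     \<not> ring.transcendental E F x \<and> ring.alg_mult E (ring.Irr E F x) x = 1)"

text \<open>
  Ramification index 1 and separable residue extension. The residue field of \<open>A\<close> is
  identified with its image in that of \<open>B\<close>.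
\<close>

definition unramified :: "('a, 'b) ring_scheme \<Rightarrow> ('a, 'b) ring_scheme \<Rightarrow> bool" where
  "unramified A B \<longleftrightarrow> Idl\<^bsub>B\<^esub> (max_ideal A) = max_ideal B \<and>
     separable_extension (residue_field B) ((\<lambda>x. max_ideal B +>\<^bsub>B\<^esub> x) ` carrier A)"


section \<open>Weak cocycles\<close>

text \<open>
  Here \<open>G\<close> is a group of functions acting on the ring \<open>A\<close> by application. Functions on
  \<open>G\<close> or \<open>G \<times> G\<close> are total HOL functions of which only the values on \<open>carrier G\<close> matter.
\<close>

definition weak_cocycles ::
  "('a \<Rightarrow> 'a) monoid \<Rightarrow> ('a, 'b) ring_scheme \<Rightarrow> (('a \<Rightarrow> 'a) \<Rightarrow> ('a \<Rightarrow> 'a) \<Rightarrow> 'a) set"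
  where
  "weak_cocycles G A = {f.
     (\<forall>\<sigma>\<in>carrier G. \<forall>\<tau>\<in>carrier G. f \<sigma> \<tau> \<in> carrier A - {\<zero>\<^bsub>A\<^esub>}) \<and>
     (\<forall>\<sigma>\<in>carrier G. \<forall>\<tau>\<in>carrier G. \<forall>\<rho>\<in>carrier G.
        f \<sigma> \<tau> \<otimes>\<^bsub>A\<^esub> f (\<sigma> \<otimes>\<^bsub>G\<^esub> \<tau>) \<rho> = \<sigma> (f \<tau> \<rho>) \<otimes>\<^bsub>A\<^esub> f \<sigma> (\<tau> \<otimes>\<^bsub>G\<^esub> \<rho>)) \<and>
     (\<forall>\<sigma>\<in>carrier G. f \<one>\<^bsub>G\<^esub> \<sigma> = \<one>\<^bsub>A\<^esub> \<and> f \<sigma> \<one>\<^bsub>G\<^esub> = \<one>\<^bsub>A\<^esub>)}"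

definition Sl :: "('g, 'c) monoid_scheme \<Rightarrow> ('g \<Rightarrow> nat) set" where
  "Sl G = {r. r \<one>\<^bsub>G\<^esub> = 0 \<and>
     (\<forall>\<sigma>\<in>carrier G. \<forall>\<tau>\<in>carrier G. r (\<sigma> \<otimes>\<^bsub>G\<^esub> \<tau>) \<le> r \<sigma> + r \<tau>)}"

definition unif_unit :: "('a, 'b) ring_scheme \<Rightarrow> 'a \<Rightarrow> ('a \<Rightarrow> 'a) \<Rightarrow> 'a" where
  "unif_unit A \<pi> \<sigma> = (THE w. w \<in> Units A \<and> \<sigma> \<pi> = w \<otimes>\<^bsub>A\<^esub> \<pi>)"

definition unit_part :: "('a, 'b) ring_scheme \<Rightarrow> 'a \<Rightarrow> 'a \<Rightarrow> 'a" where
  "unit_part A \<pi> x =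
     (THE w. w \<in> Units A \<and> x = w \<otimes>\<^bsub>A\<^esub> \<pi> [^]\<^bsub>A\<^esub> adic_val A (PIdl\<^bsub>A\<^esub> \<pi>) x)"

text \<open>For \<open>r \<in> Sl G\<close> the natural-number subtraction does not truncate.\<close>

definition b_cocycle ::
  "('a \<Rightarrow> 'a) monoid \<Rightarrow> ('a, 'b) ring_scheme \<Rightarrow> 'a \<Rightarrow> (('a \<Rightarrow> 'a) \<Rightarrow> nat)
     \<Rightarrow> ('a \<Rightarrow> 'a) \<Rightarrow> ('a \<Rightarrow> 'a) \<Rightarrow> 'a" where
  "b_cocycle G A \<pi> r \<sigma> \<tau> =
     unif_unit A \<pi> \<sigma> [^]\<^bsub>A\<^esub> r \<tau> \<otimes>\<^bsub>A\<^esub> \<pi> [^]\<^bsub>A\<^esub> (r \<sigma> + r \<tau> - r (\<sigma> \<otimes>\<^bsub>G\<^esub> \<tau>))"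

end

theory Submission
  imports Defs
begin

text \<open>
  Every nonzero element of \<open>S\<close> is a unit times a power of \<open>\<pi>\<close>: as \<open>S\<close> is local with maximal ideal
  \<open>\<pi>S\<close>, it suffices that no nonzero \<open>x\<close> lies in every \<open>\<pi>\<^sup>n S\<close>; an integral equation for \<open>x\<close>
  provides a nonzero multiple of \<open>x\<close> in \<open>R\<close>, and there the claim follows from \<open>pS = \<pi>S\<close> for a
  uniformizer \<open>p\<close> of \<open>R\<close>. The Galois group preserves the resulting valuation \<open>v\<close>, so the cocycle
  identity gives \<open>r(\<sigma>) + r(\<tau>) - r(\<sigma>\<tau>) = v(f(\<sigma>, \<tau>)) + v(f(\<tau>\<^sup>-\<^sup>1, \<sigma>\<^sup>-\<^sup>1))\<close> for \<open>r = r\<^sub>f\<close>. Hence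
  \<open>r\<close> is subadditive and \<open>f h = b\<^sub>r\<close>, and \<open>h\<close> is a cocycle since \<open>f\<close> and \<open>b\<^sub>r\<close> are and \<open>f\<close> can be
  cancelled in the domain \<open>S\<close>.
\<close>

section \<open>Maximal and principal ideals\<close>

text \<open>Zorn's lemma is applied to the ideals that contain \<open>x\<close> and avoid
  \<open>\<one>\<close>; a maximal one among them is maximal among all proper ideals. For
  \<open>x\<close> zero this yields the existence of a maximal ideal.\<close>

lemma (in cring) nonunit_in_maximalideal:
  assumes "x \<in> carrier R" and "x \<notin> Units R"
  shows "\<exists>M. maximalideal M R \<and> x \<in> M"
proof -
  define C where "C = {I. ideal I R \<and> x \<in> I \<and> \<one> \<notin> I}"
  have "\<one> \<notin> PIdl x"
    using assms m_comm unfolding cgenideal_def Units_def by force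
  then have xC: "PIdl x \<in> C"
    unfolding C_def using cgenideal_ideal[OF assms(1)] cgenideal_self[OF assms(1)] by simp
  have "\<exists>M\<in>C. \<forall>J\<in>C. M \<subseteq> J \<longrightarrow> J = M"
  proof (rule subset_Zorn_nonempty)
    show "C \<noteq> {}" using xC by auto
    fix D assume D: "D \<noteq> {}" "subset.chain C D"
    then have "subset.chain {I. ideal I R} D"
      unfolding pred_on.chain_def C_def by blast
    from chain_Union_is_ideal[OF this] D(1) have "ideal (\<Union>D) R" by simp
    then show "\<Union>D \<in> C"
      using D unfolding C_def pred_on.chain_def by blast
  qed
  then obtain M where M: "M \<in> C" and max: "\<And>J. J \<in> C \<Longrightarrow> M \<subseteq> J \<Longrightarrow> J = M"
    by blast
  interpret M: ideal M R using M unfolding C_def by simp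
  have "maximalideal M R"
  proof (rule maximalidealI)
    show "ideal M R" by (rule M.is_ideal)
    show "carrier R \<noteq> M" using M unfolding C_def by auto
    fix J assume J: "ideal J R" "M \<subseteq> J" "J \<subseteq> carrier R"
    show "J = M \<or> J = carrier R"
    proof (cases "\<one> \<in> J")
      case True then show ?thesis using ideal.one_imp_carrier[OF J(1)] by simp
    next
      case False
      then have "J \<in> C" using J M unfolding C_def by auto
      then show ?thesis using max J by blast
    qed
  qed
  then show ?thesis using M unfolding C_def by blast
qed

text \<open>Turns the ideal powers in \<open>adic_val\<close> into divisibility by powers of a
  single element.\<close>

lemma (in cring) ideal_power_cgenideal:
  assumes x: "x \<in> carrier R"
  shows "ideal_power R (PIdl x) n = PIdl (x [^] (n::nat))"
proof (induction n)
  case 0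
  have "PIdl \<one> = carrier R" unfolding cgenideal_def by force
  then show ?case by (simp add: ideal_power_def ideals_set_def nat_pow_def)
next
  case (Suc n)
  have "ideal_power R (PIdl x) (Suc n) = ideal_prod R (PIdl (x [^] n)) (PIdl x)"
    using Suc by (simp add: ideal_power_def ideals_set_def nat_pow_def)
  \<comment> \<open>\<open>ideal_prod\<close> is the ideal generated by all products; here these
    already form a principal ideal, so \<open>Idl\<close> adds nothing.\<close>
  also have "\<dots> = Idl (PIdl (x [^] Suc n))"
    using x by (simp add: ideal_prod_eq_genideal cgenideal_ideal cgenideal_prod)
  also have "\<dots> = PIdl (x [^] Suc n)"
    by (meson x Idl_subset_ideal cgenideal_ideal nat_pow_closed genideal_self
        ideal.Icarr order_refl subsetI subset_antisym)
  finally show ?case .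
qed

lemma ring_hom_Units:
  assumes "ring R" "ring S" "h \<in> ring_hom R S" "w \<in> Units R"
  shows "h w \<in> Units S"
proof -
  interpret ring_hom_ring R S h using assms ring_hom_ringI2 by blast
  from assms(4) obtain v where "v \<in> carrier R" "w \<in> carrier R"
    "v \<otimes>\<^bsub>R\<^esub> w = \<one>\<^bsub>R\<^esub>" "w \<otimes>\<^bsub>R\<^esub> v = \<one>\<^bsub>R\<^esub>"
    unfolding Units_def by blast
  then show ?thesis
    unfolding Units_def by (auto simp flip: hom_mult intro!: bexI[of _ "h v"])
qed

section \<open>Valuations and unit parts\<close>

text \<open>A discrete valuation ring with uniformizer \<pi>, described through factorizations. The
  cocycle computations work with this form; the integral closure is shown to satisfy it further
  on.\<close>

locale uniformized_domain = domain A for A (structure) and \<pi> +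
  assumes uniformizer_closed [simp]: "\<pi> \<in> carrier A"
    and uniformizer_nonzero: "\<pi> \<noteq> \<zero>"
    and uniformizer_nonunit: "\<pi> \<notin> Units A"
    and factorization: "x \<in> carrier A - {\<zero>} \<Longrightarrow> \<exists>w\<in>Units A. \<exists>n::nat. x = w \<otimes> \<pi> [^] n"
begin

abbreviation val :: "'a \<Rightarrow> nat" where
  "val \<equiv> adic_val A (PIdl \<pi>)"

lemma pow_uniformizer_nonzero [simp]: "\<pi> [^] (n::nat) \<noteq> \<zero>"
  by (induction n) (simp_all add: integral_iff uniformizer_nonzero)

lemma Units_nonzero: "w \<in> Units A \<Longrightarrow> w \<noteq> \<zero>"
  by (metis Units_r_inv Units_inv_closed l_null one_not_zero)

text \<open>Powers of \<pi> cancel, so divisibility by too high a power would exhibit \<pi> as a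
  factor of the unit \<open>w\<close>.\<close>

lemma pow_uniformizer_dvd:
  assumes w: "w \<in> Units A"
  shows "w \<otimes> \<pi> [^] n \<in> PIdl (\<pi> [^] m) \<longleftrightarrow> m \<le> (n::nat)"
proof
  have wc: "w \<in> carrier A" using w by (rule Units_closed)
  show "w \<otimes> \<pi> [^] n \<in> PIdl (\<pi> [^] m)" if "m \<le> n"
  proof -
    obtain k where "n = k + m" using le_Suc_ex[OF \<open>m \<le> n\<close>] by (auto simp: add.commute)
    then have "w \<otimes> \<pi> [^] n = (w \<otimes> \<pi> [^] k) \<otimes> \<pi> [^] m"
      using wc by (simp add: m_assoc flip: nat_pow_mult)
    then show ?thesis
      unfolding cgenideal_def using wc by (intro CollectI exI[of _ "w \<otimes> \<pi> [^] k"] conjI) simp_all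
  qed
  show "m \<le> n" if "w \<otimes> \<pi> [^] n \<in> PIdl (\<pi> [^] m)"
  proof (rule ccontr)
    assume "\<not> m \<le> n"
    then obtain k where k: "m = n + Suc k" using less_natE[of n m] by auto
    from that obtain x where x: "x \<in> carrier A" "w \<otimes> \<pi> [^] n = x \<otimes> \<pi> [^] m"
      unfolding cgenideal_def by blast
    have "\<pi> [^] m = \<pi> [^] Suc k \<otimes> \<pi> [^] n"
      unfolding k nat_pow_mult[OF uniformizer_closed] by (simp only: add.commute)
    then have "w \<otimes> \<pi> [^] n = (x \<otimes> \<pi> [^] Suc k) \<otimes> \<pi> [^] n"
      using x by (simp only: m_assoc nat_pow_closed uniformizer_closed)
    then have "w = x \<otimes> \<pi> [^] Suc k"
      using x(1) wc by (simp only: m_rcancel nat_pow_closed uniformizer_closed m_closed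
          pow_uniformizer_nonzero not_False_eq_True)
    then have "w = \<pi> \<otimes> (x \<otimes> \<pi> [^] k)" using x by (simp add: m_ac)
    then show False
      using w x uniformizer_nonunit unit_factor[of \<pi> "x \<otimes> \<pi> [^] k"] by simp
  qed
qed

lemma val_unit_mult_pow:
  assumes "w \<in> Units A"
  shows "val (w \<otimes> \<pi> [^] (n::nat)) = n"
  \<comment> \<open>After these rewrites the predicate under \<open>GREATEST\<close> describes the
    initial segment up to \<open>n\<close>.\<close>
  unfolding adic_val_def ideal_power_cgenideal[OF uniformizer_closed] pow_uniformizer_dvd[OF assms]
  by (rule Greatest_equality) auto

text \<open>This makes the definite description in \<open>unit_part\<close> meaningful. The exponent
  of any factorization is forced to be \<open>val x\<close>, and cancelling that power determines
  the unit.\<close>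

lemma factorization_val:
  assumes "x \<in> carrier A - {\<zero>}"
  shows "\<exists>!w. w \<in> Units A \<and> x = w \<otimes> \<pi> [^] val x"
proof -
  obtain w and n :: nat where w: "w \<in> Units A" "x = w \<otimes> \<pi> [^] n"
    using factorization[OF assms] by blast
  then have n: "n = val x" using val_unit_mult_pow by simp
  show ?thesis
  proof (rule ex1I)
    show "w \<in> Units A \<and> x = w \<otimes> \<pi> [^] val x" using w n by simp
    show "y = w" if "y \<in> Units A \<and> x = y \<otimes> \<pi> [^] val x" for y
    proof -
      have "y \<otimes> \<pi> [^] val x = w \<otimes> \<pi> [^] val x" using that w n by metis
      then show ?thesis
        using that w(1) m_rcancel[OF _ _ Units_closed Units_closed, of "\<pi> [^] val x" y w] by simp
    qed
  qed
qed

lemma unit_part_Units: "x \<in> carrier A - {\<zero>} \<Longrightarrow> unit_part A \<pi> x \<in> Units A"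
  and unit_part_mult_pow:
    "x \<in> carrier A - {\<zero>} \<Longrightarrow> unit_part A \<pi> x \<otimes> \<pi> [^] val x = x"
  unfolding unit_part_def using theI'[OF factorization_val, of x] by auto

lemma val_mult:
  assumes "x \<in> carrier A - {\<zero>}" "y \<in> carrier A - {\<zero>}"
  shows "val (x \<otimes> y) = val x + val y"
proof -
  let ?c = "unit_part A \<pi> x" and ?d = "unit_part A \<pi> y"
  have cd: "?c \<in> Units A" "?d \<in> Units A" using assms unit_part_Units by auto
  have "x \<otimes> y = (?c \<otimes> \<pi> [^] val x) \<otimes> (?d \<otimes> \<pi> [^] val y)"
    using assms unit_part_mult_pow by simp
  also have "\<dots> = (?c \<otimes> ?d) \<otimes> \<pi> [^] (val x + val y)"
    using cd by (simp add: Units_closed m_ac flip: nat_pow_mult)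
  finally show ?thesis using cd val_unit_mult_pow by simp
qed

lemma val_one: "val \<one> = 0"
  using val_unit_mult_pow[of \<one> 0] by simp

end

section \<open>Cocycles over a discretely valued domain\<close>

text \<open>The action is by ring endomorphisms; that they are bijective on \<open>carrier A\<close>
  follows from the group laws.\<close>

locale uniformized_action = uniformized_domain A \<pi> + G: group G
  for A :: "('a, 'b) ring_scheme" (structure) and \<pi> :: 'a and G :: "('a \<Rightarrow> 'a) monoid" +
  assumes action_hom: "\<gamma> \<in> carrier G \<Longrightarrow> \<gamma> \<in> ring_hom A A"
    and action_one: "x \<in> carrier A \<Longrightarrow> \<one>\<^bsub>G\<^esub> x = x"
    and action_mult: "\<gamma> \<in> carrier G \<Longrightarrow> \<tau> \<in> carrier G \<Longrightarrow> x \<in> carrier A \<Longrightarrow> (\<gamma> \<otimes>\<^bsub>G\<^esub> \<tau>) x = \<gamma> (\<tau> x)"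
begin

lemma action_simps [simp]:
  assumes "\<gamma> \<in> carrier G" "x \<in> carrier A"
  shows "\<gamma> x \<in> carrier A" "y \<in> carrier A \<Longrightarrow> \<gamma> (x \<otimes> y) = \<gamma> x \<otimes> \<gamma> y"
    "\<gamma> \<one> = \<one>" "\<gamma> \<zero> = \<zero>" "\<gamma> (x [^] (n::nat)) = \<gamma> x [^] n"
    "(inv\<^bsub>G\<^esub> \<gamma>) (\<gamma> x) = x" "\<gamma> ((inv\<^bsub>G\<^esub> \<gamma>) x) = x"
proof -
  interpret h: ring_hom_ring A A \<gamma>
    using assms(1) action_hom ring_axioms ring_hom_ringI2 by blast
  show "\<gamma> x \<in> carrier A" "y \<in> carrier A \<Longrightarrow> \<gamma> (x \<otimes> y) = \<gamma> x \<otimes> \<gamma> y"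
    "\<gamma> \<one> = \<one>" "\<gamma> \<zero> = \<zero>" "\<gamma> (x [^] (n::nat)) = \<gamma> x [^] n"
    using assms(2) by (simp_all add: h.hom_nat_pow)
  show "(inv\<^bsub>G\<^esub> \<gamma>) (\<gamma> x) = x" "\<gamma> ((inv\<^bsub>G\<^esub> \<gamma>) x) = x"
    using assms by (simp_all add: action_one flip: action_mult)
qed

lemma action_eq_zero_iff [simp]:
  "\<gamma> \<in> carrier G \<Longrightarrow> x \<in> carrier A \<Longrightarrow> \<gamma> x = \<zero> \<longleftrightarrow> x = \<zero>"
  by (metis G.inv_closed action_simps(4,6) zero_closed)

lemma action_Units: "\<gamma> \<in> carrier G \<Longrightarrow> w \<in> Units A \<Longrightarrow> \<gamma> w \<in> Units A"
  using ring_hom_Units[OF ring_axioms ring_axioms action_hom] .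

text \<open>If the exponent of \<pi> in \<gamma>(\<pi>) were 0, then \<gamma>(\<pi>) would be a
  unit, and so would be \<pi>, its image under the inverse of \<gamma>.\<close>

lemma action_uniformizer_dvd:
  assumes "\<gamma> \<in> carrier G"
  shows "\<exists>s\<in>carrier A. \<gamma> \<pi> = s \<otimes> \<pi>"
proof -
  have nz: "\<gamma> \<pi> \<in> carrier A - {\<zero>}" using assms uniformizer_nonzero by simp
  obtain w and n :: nat where w: "w \<in> Units A" "\<gamma> \<pi> = w \<otimes> \<pi> [^] n"
    using factorization[OF nz] by blast
  have "n \<noteq> 0"
  proof
    assume "n = 0"
    then have "\<gamma> \<pi> \<in> Units A" using w by (simp add: Units_closed)
    from action_Units[OF G.inv_closed[OF assms] this] show False
      using assms uniformizer_nonunit by simp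
  qed
  then obtain k where "n = Suc k" using not0_implies_Suc by blast
  then have "\<gamma> \<pi> = (w \<otimes> \<pi> [^] k) \<otimes> \<pi>" using w by (simp add: m_assoc Units_closed)
  then show ?thesis using w by (auto simp: Units_closed)
qed

text \<open>With \<open>s\<close> and \<open>t\<close> the multipliers for \<gamma> and its inverse,
  \<pi> equals \<open>\<gamma> t \<otimes> s \<otimes> \<pi>\<close>, so \<open>s\<close> is
  invertible. Hence \<open>unif_unit\<close> is well defined.\<close>

lemma ex1_unif_unit:
  assumes \<gamma>: "\<gamma> \<in> carrier G"
  shows "\<exists>!w. w \<in> Units A \<and> \<gamma> \<pi> = w \<otimes> \<pi>"
proof -
  let ?\<tau> = "inv\<^bsub>G\<^esub> \<gamma>"
  obtain s where s: "s \<in> carrier A" "\<gamma> \<pi> = s \<otimes> \<pi>"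
    using action_uniformizer_dvd \<gamma> by blast
  obtain t where t: "t \<in> carrier A" "?\<tau> \<pi> = t \<otimes> \<pi>"
    using action_uniformizer_dvd \<gamma> by (meson G.inv_closed)
  have "\<one> \<otimes> \<pi> = \<gamma> (?\<tau> \<pi>)" using \<gamma> by simp
  also have "\<dots> = \<gamma> t \<otimes> s \<otimes> \<pi>" using \<gamma> s t by (simp add: m_assoc del: action_simps(7))
  finally have "\<gamma> t \<otimes> s = \<one>"
    using m_rcancel[of \<pi> \<one> "\<gamma> t \<otimes> s"] \<gamma> s t uniformizer_nonzero by simp
  then have "s \<in> Units A"
    using \<gamma> s t m_comm[of s "\<gamma> t"] unfolding Units_def by auto
  then show ?thesis
    using s m_rcancel[of \<pi>] uniformizer_nonzero by (auto intro!: ex1I[of _ s] simp: Units_closed)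
qed

abbreviation u where "u \<equiv> unif_unit A \<pi>"

lemma unif_unit_Units: "\<gamma> \<in> carrier G \<Longrightarrow> u \<gamma> \<in> Units A"
  and action_uniformizer: "\<gamma> \<in> carrier G \<Longrightarrow> \<gamma> \<pi> = u \<gamma> \<otimes> \<pi>"
  unfolding unif_unit_def using theI'[OF ex1_unif_unit, of \<gamma>] by auto

lemma unif_unit_closed [simp]: "\<gamma> \<in> carrier G \<Longrightarrow> u \<gamma> \<in> carrier A"
  using unif_unit_Units by (simp add: Units_closed)

lemma unif_unit_one: "u \<one>\<^bsub>G\<^esub> = \<one>"
  using action_uniformizer[of "\<one>\<^bsub>G\<^esub>"] m_rcancel[of \<pi> "u \<one>\<^bsub>G\<^esub>" \<one>] uniformizer_nonzero
  by (simp add: action_one)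

text \<open>Expanding the image of \<pi> under the product in two ways and cancelling \<pi> shows
  that \<open>u\<close> is a crossed homomorphism into the units.\<close>

lemma unif_unit_mult:
  assumes "\<gamma> \<in> carrier G" "\<tau> \<in> carrier G"
  shows "u (\<gamma> \<otimes>\<^bsub>G\<^esub> \<tau>) = \<gamma> (u \<tau>) \<otimes> u \<gamma>"
proof -
  have "u (\<gamma> \<otimes>\<^bsub>G\<^esub> \<tau>) \<otimes> \<pi> = \<gamma> (\<tau> \<pi>)"
    using assms action_uniformizer[of "\<gamma> \<otimes>\<^bsub>G\<^esub> \<tau>"] by (simp add: action_mult)
  also have "\<dots> = (\<gamma> (u \<tau>) \<otimes> u \<gamma>) \<otimes> \<pi>"
    using assms by (simp add: action_uniformizer m_assoc)
  finally show ?thesis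
    using assms m_rcancel[of \<pi>] uniformizer_nonzero by simp
qed

text \<open>Units stay units under \<gamma>, and \<gamma>(\<pi>) differs from \<pi> by the unit
  \<open>u \<gamma>\<close>, so the exponent of \<pi> is unchanged.\<close>

lemma val_action:
  assumes "\<gamma> \<in> carrier G" "x \<in> carrier A - {\<zero>}"
  shows "val (\<gamma> x) = val x"
proof -
  let ?c = "unit_part A \<pi> x" and ?n = "val x"
  have c: "?c \<in> Units A" using assms unit_part_Units by simp
  have "\<gamma> x = \<gamma> (?c \<otimes> \<pi> [^] ?n)" using assms unit_part_mult_pow by simp
  also have "\<dots> = (\<gamma> ?c \<otimes> u \<gamma> [^] ?n) \<otimes> \<pi> [^] ?n"
    using assms c by (simp add: Units_closed action_uniformizer nat_pow_distrib m_assoc)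
  finally show ?thesis
    using assms c action_Units unif_unit_Units val_unit_mult_pow Units_pow_closed by simp
qed

text \<open>By the crossed homomorphism rule for \<open>u\<close>, both sides of the cocycle
  identity reduce to \<open>(V [^] r \<rho> \<otimes> U [^] (r \<tau> + r \<rho>)) \<otimes> \<pi>
  [^] ?n\<close>, where \<open>U\<close> is \<open>u \<gamma>\<close> and \<open>V\<close> is
  \<open>\<gamma> (u \<tau>)\<close>.\<close>

lemma b_cocycle_weak_cocycle:
  assumes r: "r \<in> Sl G"
  shows "b_cocycle G A \<pi> r \<in> weak_cocycles G A"
proof -
  have r1: "r \<one>\<^bsub>G\<^esub> = 0" and sub: "\<And>\<gamma> \<tau>. \<gamma> \<in> carrier G \<Longrightarrow> \<tau> \<in> carrier G \<Longrightarrow> r (\<gamma> \<otimes>\<^bsub>G\<^esub> \<tau>) \<le> r \<gamma> + r \<tau>"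
    using r unfolding Sl_def by auto
  have "b_cocycle G A \<pi> r \<gamma> \<tau> \<otimes> b_cocycle G A \<pi> r (\<gamma> \<otimes>\<^bsub>G\<^esub> \<tau>) \<rho>
      = \<gamma> (b_cocycle G A \<pi> r \<tau> \<rho>) \<otimes> b_cocycle G A \<pi> r \<gamma> (\<tau> \<otimes>\<^bsub>G\<^esub> \<rho>)"
    if G: "\<gamma> \<in> carrier G" "\<tau> \<in> carrier G" "\<rho> \<in> carrier G" for \<gamma> \<tau> \<rho>
  proof -
    let ?st = "\<gamma> \<otimes>\<^bsub>G\<^esub> \<tau>" and ?tr = "\<tau> \<otimes>\<^bsub>G\<^esub> \<rho>"
    let ?n = "r \<gamma> + r \<tau> + r \<rho> - r (?st \<otimes>\<^bsub>G\<^esub> \<rho>)"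
    define U V where "U = u \<gamma>" and "V = \<gamma> (u \<tau>)"
    have c: "U \<in> carrier A" "V \<in> carrier A" using G by (simp_all add: U_def V_def)
    have uv: "u ?st = V \<otimes> U" "\<gamma> \<pi> = U \<otimes> \<pi>"
      using G by (simp_all add: unif_unit_mult action_uniformizer U_def V_def)
    have asc: "\<gamma> \<otimes>\<^bsub>G\<^esub> ?tr = ?st \<otimes>\<^bsub>G\<^esub> \<rho>" using G by (simp add: G.m_assoc)
    have s: "r ?st \<le> r \<gamma> + r \<tau>" "r ?tr \<le> r \<tau> + r \<rho>"
      "r (?st \<otimes>\<^bsub>G\<^esub> \<rho>) \<le> r ?st + r \<rho>" "r (?st \<otimes>\<^bsub>G\<^esub> \<rho>) \<le> r \<gamma> + r ?tr"
      using sub[of \<gamma> \<tau>] sub[of \<tau> \<rho>] sub[of ?st \<rho>] sub[of \<gamma> ?tr] G asc by simp_all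
    \<comment> \<open>Subadditivity keeps every natural subtraction exact; the intermediate terms
      \<open>r ?st\<close> and \<open>r ?tr\<close> then telescope.\<close>
    have n: "(r \<gamma> + r \<tau> - r ?st) + (r ?st + r \<rho> - r (?st \<otimes>\<^bsub>G\<^esub> \<rho>)) = ?n"
      "(r \<tau> + r \<rho> - r ?tr) + (r \<gamma> + r ?tr - r (?st \<otimes>\<^bsub>G\<^esub> \<rho>)) = ?n"
      using s by linarith+
    have "b_cocycle G A \<pi> r \<gamma> \<tau> \<otimes> b_cocycle G A \<pi> r ?st \<rho>
      = (V [^] r \<rho> \<otimes> (U [^] r \<tau> \<otimes> U [^] r \<rho>)) \<otimes>
        (\<pi> [^] (r \<gamma> + r \<tau> - r ?st) \<otimes> \<pi> [^] (r ?st + r \<rho> - r (?st \<otimes>\<^bsub>G\<^esub> \<rho>)))"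
      using c by (simp add: b_cocycle_def uv nat_pow_distrib m_ac flip: U_def)
    also have "\<dots> = (V [^] r \<rho> \<otimes> U [^] (r \<tau> + r \<rho>)) \<otimes> \<pi> [^] ?n"
      using c by (simp only: nat_pow_mult uniformizer_closed n)
    \<comment> \<open>The powers of \<open>U\<close> on the right have two sources: \<gamma> acting
      on the power of \<pi> in the first factor, and the explicit power of \<open>u \<gamma>\<close>
      in the second.\<close>
    also have "\<dots> = (V [^] r \<rho> \<otimes> (U [^] (r \<tau> + r \<rho> - r ?tr) \<otimes> U [^] r ?tr)) \<otimes>
        (\<pi> [^] (r \<tau> + r \<rho> - r ?tr) \<otimes> \<pi> [^] (r \<gamma> + r ?tr - r (?st \<otimes>\<^bsub>G\<^esub> \<rho>)))"
      using c s(2) by (simp only: nat_pow_mult uniformizer_closed n le_add_diff_inverse2)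
    also have "\<dots> = \<gamma> (b_cocycle G A \<pi> r \<tau> \<rho>) \<otimes> b_cocycle G A \<pi> r \<gamma> ?tr"
      using c G by (simp add: b_cocycle_def uv nat_pow_distrib m_ac asc flip: U_def V_def)
    finally show ?thesis .
  qed
  moreover have "b_cocycle G A \<pi> r \<gamma> \<tau> \<in> carrier A - {\<zero>}"
    if "\<gamma> \<in> carrier G" "\<tau> \<in> carrier G" for \<gamma> \<tau>
    using that unif_unit_Units Units_pow_closed[of "u \<gamma>" "r \<tau>"] Units_nonzero
    by (simp add: b_cocycle_def integral_iff)
  ultimately show ?thesis
    unfolding weak_cocycles_def
    by (auto simp: b_cocycle_def r1 unif_unit_one)
qed

text \<open>Since \<gamma> is multiplicative, multiplying the identity wanted for \<open>h\<close>
  by the identity for \<open>f\<close> gives the one for \<open>b\<close>. The common factor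
  \<open>?F\<close> is nonzero and cancels.\<close>

lemma weak_cocycles_quotient:
  assumes f: "f \<in> weak_cocycles G A" and b: "b \<in> weak_cocycles G A"
    and h: "\<And>\<gamma> \<tau>. \<gamma> \<in> carrier G \<Longrightarrow> \<tau> \<in> carrier G \<Longrightarrow> h \<gamma> \<tau> \<in> carrier A"
    and fh: "\<And>\<gamma> \<tau>. \<gamma> \<in> carrier G \<Longrightarrow> \<tau> \<in> carrier G \<Longrightarrow> f \<gamma> \<tau> \<otimes> h \<gamma> \<tau> = b \<gamma> \<tau>"
  shows "h \<in> weak_cocycles G A"
proof -
  have f': "f \<gamma> \<tau> \<in> carrier A" "f \<gamma> \<tau> \<noteq> \<zero>" "b \<gamma> \<tau> \<in> carrier A" "b \<gamma> \<tau> \<noteq> \<zero>"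
    if "\<gamma> \<in> carrier G" "\<tau> \<in> carrier G" for \<gamma> \<tau>
    using that f b unfolding weak_cocycles_def by auto
  have cf: "f \<gamma> \<tau> \<otimes> f (\<gamma> \<otimes>\<^bsub>G\<^esub> \<tau>) \<rho> = \<gamma> (f \<tau> \<rho>) \<otimes> f \<gamma> (\<tau> \<otimes>\<^bsub>G\<^esub> \<rho>)"
    and cb: "b \<gamma> \<tau> \<otimes> b (\<gamma> \<otimes>\<^bsub>G\<^esub> \<tau>) \<rho> = \<gamma> (b \<tau> \<rho>) \<otimes> b \<gamma> (\<tau> \<otimes>\<^bsub>G\<^esub> \<rho>)"
    if "\<gamma> \<in> carrier G" "\<tau> \<in> carrier G" "\<rho> \<in> carrier G" for \<gamma> \<tau> \<rho>
    using that f b unfolding weak_cocycles_def by auto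
  have "h \<gamma> \<tau> \<otimes> h (\<gamma> \<otimes>\<^bsub>G\<^esub> \<tau>) \<rho> = \<gamma> (h \<tau> \<rho>) \<otimes> h \<gamma> (\<tau> \<otimes>\<^bsub>G\<^esub> \<rho>)"
    if G: "\<gamma> \<in> carrier G" "\<tau> \<in> carrier G" "\<rho> \<in> carrier G" for \<gamma> \<tau> \<rho>
  proof -
    let ?F = "f \<gamma> \<tau> \<otimes> f (\<gamma> \<otimes>\<^bsub>G\<^esub> \<tau>) \<rho>"
    have "?F \<otimes> (h \<gamma> \<tau> \<otimes> h (\<gamma> \<otimes>\<^bsub>G\<^esub> \<tau>) \<rho>)
        = (f \<gamma> \<tau> \<otimes> h \<gamma> \<tau>) \<otimes> (f (\<gamma> \<otimes>\<^bsub>G\<^esub> \<tau>) \<rho> \<otimes> h (\<gamma> \<otimes>\<^bsub>G\<^esub> \<tau>) \<rho>)"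
      using G f' h by (simp add: m_ac)
    also have "\<dots> = \<gamma> (f \<tau> \<rho> \<otimes> h \<tau> \<rho>) \<otimes> (f \<gamma> (\<tau> \<otimes>\<^bsub>G\<^esub> \<rho>) \<otimes> h \<gamma> (\<tau> \<otimes>\<^bsub>G\<^esub> \<rho>))"
      using G by (simp add: fh cb)
    also have "\<dots> = (\<gamma> (f \<tau> \<rho>) \<otimes> f \<gamma> (\<tau> \<otimes>\<^bsub>G\<^esub> \<rho>)) \<otimes> (\<gamma> (h \<tau> \<rho>) \<otimes> h \<gamma> (\<tau> \<otimes>\<^bsub>G\<^esub> \<rho>))"
      using G f' h by (simp add: m_ac)
    finally show ?thesis
      using G f' h m_lcancel[of ?F] by (simp add: integral_iff flip: cf)
  qed
  moreover have "h \<gamma> \<tau> \<noteq> \<zero>" if "\<gamma> \<in> carrier G" "\<tau> \<in> carrier G" for \<gamma> \<tau>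
    using that fh[of \<gamma> \<tau>] f'[of \<gamma> \<tau>] by auto
  moreover have "h \<one>\<^bsub>G\<^esub> \<gamma> = \<one> \<and> h \<gamma> \<one>\<^bsub>G\<^esub> = \<one>" if "\<gamma> \<in> carrier G" for \<gamma>
    using that fh[of "\<one>\<^bsub>G\<^esub>" \<gamma>] fh[of \<gamma> "\<one>\<^bsub>G\<^esub>"] h f b unfolding weak_cocycles_def by simp
  ultimately show ?thesis unfolding weak_cocycles_def using h by auto
qed

section \<open>The valuation function of a fixed cocycle and the complementary cocycle\<close>

context
  fixes f r
  assumes f: "f \<in> weak_cocycles G A"
    and r_def: "r = (\<lambda>\<gamma>. val (f \<gamma> (inv\<^bsub>G\<^esub> \<gamma>)))"
begin

lemma cocycle_nonzero:
  "\<gamma> \<in> carrier G \<Longrightarrow> \<tau> \<in> carrier G \<Longrightarrow> f \<gamma> \<tau> \<in> carrier A - {\<zero>}"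
  using f unfolding weak_cocycles_def by blast

text \<open>As \<open>val\<close> is invariant under the action and turns products into sums, the
  valuations of \<open>f\<close> form an additive 2-cocycle for the trivial action.\<close>

lemma val_cocycle:
  assumes "\<gamma> \<in> carrier G" "\<tau> \<in> carrier G" "\<rho> \<in> carrier G"
  shows "val (f \<gamma> \<tau>) + val (f (\<gamma> \<otimes>\<^bsub>G\<^esub> \<tau>) \<rho>) = val (f \<tau> \<rho>) + val (f \<gamma> (\<tau> \<otimes>\<^bsub>G\<^esub> \<rho>))"
proof -
  have "f \<gamma> \<tau> \<otimes> f (\<gamma> \<otimes>\<^bsub>G\<^esub> \<tau>) \<rho> = \<gamma> (f \<tau> \<rho>) \<otimes> f \<gamma> (\<tau> \<otimes>\<^bsub>G\<^esub> \<rho>)"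
    using f assms unfolding weak_cocycles_def by blast
  from arg_cong[OF this, of val] show ?thesis
    using assms cocycle_nonzero by (simp add: val_mult val_action)
qed

lemma val_cocycle_one:
  "\<gamma> \<in> carrier G \<Longrightarrow> val (f \<gamma> \<one>\<^bsub>G\<^esub>) = 0" "\<gamma> \<in> carrier G \<Longrightarrow> val (f \<one>\<^bsub>G\<^esub> \<gamma>) = 0"
  using f unfolding weak_cocycles_def by (simp_all add: val_one)

text \<open>
  Add the valuations of the cocycle identities at \<open>(\<gamma>, \<tau>, \<tau>\<^sup>-\<^sup>1)\<close> and
  \<open>(\<gamma>\<tau>, \<tau>\<^sup>-\<^sup>1, \<gamma>\<^sup>-\<^sup>1)\<close>.
\<close>

lemma val_cocycle_defect:
  assumes "\<gamma> \<in> carrier G" "\<tau> \<in> carrier G"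
  shows "r \<gamma> + r \<tau> = r (\<gamma> \<otimes>\<^bsub>G\<^esub> \<tau>) + val (f \<gamma> \<tau>) + val (f (inv\<^bsub>G\<^esub> \<tau>) (inv\<^bsub>G\<^esub> \<gamma>))"
proof -
  have "\<gamma> \<otimes>\<^bsub>G\<^esub> \<tau> \<otimes>\<^bsub>G\<^esub> inv\<^bsub>G\<^esub> \<tau> = \<gamma>" using assms by (simp add: G.m_assoc)
  then show ?thesis
    using assms val_cocycle[of \<gamma> \<tau> "inv\<^bsub>G\<^esub> \<tau>"]
      val_cocycle[of "\<gamma> \<otimes>\<^bsub>G\<^esub> \<tau>" "inv\<^bsub>G\<^esub> \<tau>" "inv\<^bsub>G\<^esub> \<gamma>"]
    by (simp add: r_def G.inv_mult_group val_cocycle_one)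
qed

text \<open>The defect in \<open>val_cocycle_defect\<close> is a sum of two natural numbers, hence
  subadditivity; the value at the identity is the valuation of \<open>\<one>\<close>.\<close>

lemma val_cocycle_Sl: "r \<in> Sl G"
  using val_cocycle_defect val_cocycle_one(1)[of "\<one>\<^bsub>G\<^esub>"]
  unfolding Sl_def by (auto simp: r_def)

text \<open>The inverse of \<open>C \<otimes> D\<close> in \<open>h\<close> removes the unit parts
  of both values of \<open>f\<close>. What remains is the power of \<open>u \<gamma>\<close> times
  \<pi> to the sum of two valuations, and \<open>val_cocycle_defect\<close> identifies that sum with
  the exponent in \<open>b_cocycle\<close>.\<close>

lemma cocycle_complement:
  assumes c: "c = (\<lambda>\<gamma> \<tau>. unit_part A \<pi> (f \<gamma> \<tau>))"
    and h: "h = (\<lambda>\<gamma> \<tau>. inv (c \<gamma> \<tau> \<otimes> c (inv\<^bsub>G\<^esub> \<tau>) (inv\<^bsub>G\<^esub> \<gamma>))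
                  \<otimes> u \<gamma> [^] r \<tau> \<otimes> f (inv\<^bsub>G\<^esub> \<tau>) (inv\<^bsub>G\<^esub> \<gamma>))"
  shows "h \<in> weak_cocycles G A"
    and "\<And>\<gamma> \<tau>. \<gamma> \<in> carrier G \<Longrightarrow> \<tau> \<in> carrier G \<Longrightarrow> f \<gamma> \<tau> \<otimes> h \<gamma> \<tau> = b_cocycle G A \<pi> r \<gamma> \<tau>"
proof -
  have h_closed: "h \<gamma> \<tau> \<in> carrier A" and fh: "f \<gamma> \<tau> \<otimes> h \<gamma> \<tau> = b_cocycle G A \<pi> r \<gamma> \<tau>"
    if G: "\<gamma> \<in> carrier G" "\<tau> \<in> carrier G" for \<gamma> \<tau>
  proof -
    define x y where "x = f \<gamma> \<tau>" and "y = f (inv\<^bsub>G\<^esub> \<tau>) (inv\<^bsub>G\<^esub> \<gamma>)"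
    define C D where "C = unit_part A \<pi> x" and "D = unit_part A \<pi> y"
    have xy: "x \<in> carrier A - {\<zero>}" "y \<in> carrier A - {\<zero>}"
      using G cocycle_nonzero by (auto simp: x_def y_def)
    have CD: "C \<in> Units A" "D \<in> Units A" "C \<otimes> D \<in> Units A"
      using xy unit_part_Units by (auto simp: C_def D_def)
    have cl: "C \<in> carrier A" "D \<in> carrier A" "inv (C \<otimes> D) \<in> carrier A"
      using CD by (auto simp: Units_closed)
    have hst: "h \<gamma> \<tau> = inv (C \<otimes> D) \<otimes> u \<gamma> [^] r \<tau> \<otimes> y"
      by (simp add: h c C_def D_def x_def y_def)
    show "h \<gamma> \<tau> \<in> carrier A" using G xy cl by (simp add: hst)
    have n: "r \<gamma> + r \<tau> - r (\<gamma> \<otimes>\<^bsub>G\<^esub> \<tau>) = val x + val y"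
      using val_cocycle_defect[OF G] by (simp add: x_def y_def)
    have "x \<otimes> h \<gamma> \<tau>
        = (C \<otimes> \<pi> [^] val x) \<otimes> (inv (C \<otimes> D) \<otimes> u \<gamma> [^] r \<tau> \<otimes> (D \<otimes> \<pi> [^] val y))"
      using xy by (simp add: hst C_def D_def unit_part_mult_pow)
    also have "\<dots> = ((C \<otimes> D) \<otimes> inv (C \<otimes> D)) \<otimes> (u \<gamma> [^] r \<tau> \<otimes> (\<pi> [^] val x \<otimes> \<pi> [^] val y))"
      using G cl by (simp add: m_ac)
    also have "\<dots> = b_cocycle G A \<pi> r \<gamma> \<tau>"
      using G CD by (simp add: nat_pow_mult b_cocycle_def n)
    finally show "f \<gamma> \<tau> \<otimes> h \<gamma> \<tau> = b_cocycle G A \<pi> r \<gamma> \<tau>" by (simp add: x_def)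
  qed
  show "h \<in> weak_cocycles G A"
    using weak_cocycles_quotient[OF f b_cocycle_weak_cocycle[OF val_cocycle_Sl] h_closed fh] .
  show "\<And>\<gamma> \<tau>. \<gamma> \<in> carrier G \<Longrightarrow> \<tau> \<in> carrier G \<Longrightarrow> f \<gamma> \<tau> \<otimes> h \<gamma> \<tau> = b_cocycle G A \<pi> r \<gamma> \<tau>"
    by (rule fh)
qed

end

end

section \<open>The integral closure and its Galois action\<close>

text \<open>Divide by \<pi> as long as the cofactor is a nonunit and so lies in the only maximal
  ideal; \<open>sep\<close> bounds the number of divisions.\<close>

lemma (in domain) uniformized_domainI:
  assumes \<pi>: "\<pi> \<in> carrier R" "\<pi> \<noteq> \<zero>"
    and max: "\<And>M. maximalideal M R \<longleftrightarrow> M = PIdl \<pi>"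
    and sep: "\<And>x. x \<in> carrier R \<Longrightarrow> (\<And>n::nat. x \<in> PIdl (\<pi> [^] n)) \<Longrightarrow> x = \<zero>"
  shows "uniformized_domain R \<pi>"
proof -
  interpret P: maximalideal "PIdl \<pi>" R using max by blast
  have nonunit: "x \<in> PIdl \<pi>" if "x \<in> carrier R" "x \<notin> Units R" for x
    using nonunit_in_maximalideal[OF that] max by blast
  show ?thesis
  proof unfold_locales
    show "\<pi> \<in> carrier R" "\<pi> \<noteq> \<zero>" by (rule \<pi>)+
    show "\<pi> \<notin> Units R"
      using cgenideal_self[OF \<pi>(1)] ideal_eq_carrier_iff[OF \<pi>(1)] P.I_notcarr by auto
    fix x assume x: "x \<in> carrier R - {\<zero>}"
    then obtain N :: nat where N: "x \<notin> PIdl (\<pi> [^] N)" using sep by blast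
    \<comment> \<open>Here \<open>m\<close> divisions are done and \<open>k\<close> remain before
      the bound \<open>N\<close>; at \<open>k = 0\<close> the element \<open>x\<close> would be
      divisible by the excluded power.\<close>
    have "\<exists>w\<in>Units R. \<exists>n::nat. x = w \<otimes> \<pi> [^] n"
      if "y \<in> carrier R" "x = y \<otimes> \<pi> [^] m" "m + k = N" for y and k m :: nat
      using that
    proof (induction k arbitrary: y m)
      case 0
      then have "x \<in> PIdl (\<pi> [^] N)" unfolding cgenideal_def by auto
      with N show ?case by simp
    next
      case (Suc k)
      show ?case
      proof (cases "y \<in> Units R")
        case True then show ?thesis using Suc.prems by blast
      next
        case False
        then obtain z where z: "z \<in> carrier R" "y = z \<otimes> \<pi>"
          using nonunit[OF Suc.prems(1)] unfolding cgenideal_def by blast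
        have "x = z \<otimes> \<pi> [^] Suc m" using Suc.prems z \<pi> by (simp add: m_ac)
        then show ?thesis using Suc.IH[OF z(1), of "Suc m"] Suc.prems(3) by (simp only: add_Suc_right add_Suc)
      qed
    qed
    from this[of x 0 N] show "\<exists>w\<in>Units R. \<exists>n::nat. x = w \<otimes> \<pi> [^] n" using x by simp
  qed
qed

section \<open>Maximal ideals of a discrete valuation ring\<close>

lemma (in domain) zero_maximalideal_primeideal:
  assumes "maximalideal {\<zero>} R" and "primeideal P R"
  shows "P = {\<zero>}"
proof -
  interpret P: primeideal P R by fact
  show ?thesis
    using maximalideal.I_maximal[OF assms(1) P.is_ideal] P.I_notcarr P.a_subset P.zero_closed by auto
qed

text \<open>A maximal ideal is prime, and it is nonzero since otherwise \<open>P\<close> would be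
  zero too; so it equals \<open>P\<close>. With the existence of a maximal ideal this gives
  \<open>THE\<close> in \<open>max_ideal\<close> its value.\<close>

lemma discrete_valuation_ring_maximalideal:
  assumes "discrete_valuation_ring A"
  shows "maximalideal M A \<longleftrightarrow> M = max_ideal A" and "max_ideal A \<noteq> {\<zero>\<^bsub>A\<^esub>}"
proof -
  interpret principal_domain A using assms unfolding discrete_valuation_ring_def by simp
  obtain P where P: "primeideal P A" "P \<noteq> {\<zero>\<^bsub>A\<^esub>}"
    and unique: "\<And>Q. primeideal Q A \<Longrightarrow> Q \<noteq> {\<zero>\<^bsub>A\<^esub>} \<Longrightarrow> Q = P"
    using assms unfolding discrete_valuation_ring_def by metis
  have "M = P" if "maximalideal M A" for M
    using unique[OF maximalideal_prime[OF that]] zero_maximalideal_primeideal[OF _ P(1)] P(2) that by auto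
  moreover have "\<exists>M. maximalideal M A"
    using nonunit_in_maximalideal[OF zero_closed] by (auto simp: Units_def)
  ultimately have max: "maximalideal M A \<longleftrightarrow> M = P" for M by auto
  then have "max_ideal A = P" unfolding max_ideal_def by simp
  then show "maximalideal M A \<longleftrightarrow> M = max_ideal A" "max_ideal A \<noteq> {\<zero>\<^bsub>A\<^esub>}"
    using max P(2) by auto
qed

section \<open>Integral elements and their monic equations\<close>

lemma (in domain) integral_closure_subset:
  assumes "subring R' R"
  shows "R' \<subseteq> integral_closure R R'"
proof
  fix a assume a: "a \<in> R'"
  have "a \<in> carrier R" "\<ominus> a \<in> R'" using a subringE(1,5)[OF assms] by auto
  \<comment> \<open>The monic linear polynomial with root \<open>a\<close>.\<close>
  moreover have "[\<one>, \<ominus> a] \<in> carrier (R'[X])"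
    using subringE(3)[OF assms] \<open>\<ominus> a \<in> R'\<close>
    by (simp add: polynomial_def flip: univ_poly_carrier)
  ultimately show "a \<in> integral_closure R R'"
    unfolding integral_closure_def using r_neg by (auto intro!: bexI[of _ "[\<one>, \<ominus> a]"])
qed

text \<open>The constant term of a monic equation for \<open>x\<close> of minimal degree.\<close>

lemma (in domain) integral_closure_dvd:
  assumes R': "subring R' R" and S: "subring (integral_closure R R') R"
    and x: "x \<in> integral_closure R R'" "x \<noteq> \<zero>"
  shows "\<exists>a\<in>R'. a \<noteq> \<zero> \<and> (\<exists>s\<in>integral_closure R R'. a = s \<otimes> x)"
proof -
  let ?S = "integral_closure R R'"
  note RS = integral_closure_subset[OF R'] and SE = subringE[OF S]
  have xc: "x \<in> carrier R" using x SE(1) by auto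
  have eval_S: "eval p x \<in> ?S" if "set p \<subseteq> R'" for p
    using that
  proof (induction p)
    case Nil then show ?case using SE by simp
  next
    case (Cons a p)
    have "x [^] n \<in> ?S" for n :: nat
      by (induction n) (use SE x in auto)
    then show ?case using Cons RS SE by auto
  qed
  \<comment> \<open>Reverse induction strips constant terms and so stands in for the choice of a
    minimal degree.\<close>
  have *: ?thesis if "set p \<subseteq> R'" "p \<noteq> []" "hd p = \<one>" "eval p x = \<zero>" for p
    using that
  proof (induction p rule: rev_induct)
    case Nil then show ?case by simp
  next
    case (snoc a q)
    have q: "set q \<subseteq> R'" and a: "a \<in> R'" using snoc.prems(1) by auto
    have qc: "set q \<subseteq> carrier R" and ac: "a \<in> carrier R" using q a subringE(1)[OF R'] by auto
    have e: "eval q x \<in> ?S" "eval q x \<in> carrier R" using eval_S[OF q] SE(1) by auto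
    have eq: "eval q x \<otimes> x \<oplus> a = \<zero>" using eval_append_aux[OF qc ac xc] snoc.prems(4) by simp
    show ?case
    proof (cases "a = \<zero>")
      case False
      have "a = (\<ominus> eval q x) \<otimes> x"
        using eq e xc ac by (metis add.inv_equality a_comm l_minus m_closed minus_equality)
      then show ?thesis using a False SE(5)[OF e(1)] by blast
    next
      case True
      \<comment> \<open>As \<open>x\<close> is nonzero, a vanishing constant term leaves the shorter
        equation \<open>q\<close>, which is nonempty because \<open>[\<zero>]\<close> is not
        monic.\<close>
      then have "eval q x = \<zero>" using eq e xc x(2) integral_iff by simp
      moreover have "q \<noteq> []" using snoc.prems(3) True by auto
      ultimately show ?thesis using snoc.IH q snoc.prems(3) by simp
    qed
  qed
  obtain p where p: "p \<in> carrier (R'[X])" "p \<noteq> []" "hd p = \<one>" "eval p x = \<zero>"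
    using x(1) unfolding integral_closure_def by blast
  then have "set p \<subseteq> R'" by (auto simp: polynomial_def simp flip: univ_poly_carrier)
  then show ?thesis using * p by blast
qed

section \<open>The Galois group and its action on integral elements\<close>

lemma galois_group_carrier:
  "\<phi> \<in> carrier (galois_group L K) \<longleftrightarrow>
    \<phi> \<in> ring_iso L L \<and> \<phi> \<in> extensional (carrier L) \<and> (\<forall>x\<in>K. \<phi> x = x)"
  by (simp add: galois_group_def)

lemma galois_group_Bij:
  "\<phi> \<in> carrier (galois_group L K) \<Longrightarrow> \<phi> \<in> Bij (carrier L)"
  unfolding galois_group_carrier Bij_def ring_iso_def by simp

lemma galois_group_mult:
  assumes "\<phi> \<in> carrier (galois_group L K)" "\<psi> \<in> carrier (galois_group L K)"
  shows "\<phi> \<otimes>\<^bsub>galois_group L K\<^esub> \<psi> = compose (carrier L) \<phi> \<psi>"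
  using assms[THEN galois_group_Bij] by (simp add: galois_group_def BijGroup_def)

text \<open>It is a subgroup of \<open>BijGroup\<close>. Identity, inverses and composites are
  restricted to the carrier to be extensional, and they still fix \<open>K\<close> because
  \<open>K\<close> lies in the carrier.\<close>

lemma (in ring) galois_group_is_group:
  assumes K: "K \<subseteq> carrier R"
  shows "group (galois_group R K)"
proof -
  let ?C = "carrier (galois_group R K)"
  have "subgroup ?C (BijGroup (carrier R))"
  proof (rule group.subgroupI[OF group_BijGroup])
    show "?C \<subseteq> carrier (BijGroup (carrier R))"
      using galois_group_Bij by (auto simp: BijGroup_def)
    have "(\<lambda>x\<in>carrier R. x) \<in> ring_iso R R"
      by (auto simp: ring_iso_def ring_hom_def bij_betw_def inj_on_def)
    then have "(\<lambda>x\<in>carrier R. x) \<in> ?C" using K by (auto simp: galois_group_carrier)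
    then show "?C \<noteq> {}" by auto
  next
    fix \<phi> assume \<phi>: "\<phi> \<in> ?C"
    let ?\<psi> = "\<lambda>x\<in>carrier R. inv_into (carrier R) \<phi> x"
    have iso: "\<phi> \<in> ring_iso R R" using \<phi> galois_group_carrier by blast
    then have inj: "inj_on \<phi> (carrier R)" by (simp add: ring_iso_def bij_betw_def)
    have "inv_into (carrier R) \<phi> \<in> ring_iso R R" using ring_iso_set_sym[OF ring_axioms iso] .
    then have "?\<psi> \<in> ring_iso R R"
      by (auto simp: ring_iso_def ring_hom_def cong: bij_betw_cong)
    moreover have "?\<psi> x = x" if "x \<in> K" for x
      using that K \<phi> inv_into_f_f[OF inj, of x] by (auto simp: galois_group_carrier)
    ultimately show "inv\<^bsub>BijGroup (carrier R)\<^esub> \<phi> \<in> ?C"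
      using inv_BijGroup[OF galois_group_Bij[OF \<phi>]] by (simp add: galois_group_carrier)
  next
    fix \<phi> \<psi> assume \<phi>\<psi>: "\<phi> \<in> ?C" "\<psi> \<in> ?C"
    have "\<phi> \<circ> \<psi> \<in> ring_iso R R" using \<phi>\<psi> ring_iso_set_trans galois_group_carrier by blast
    then have "compose (carrier R) \<phi> \<psi> \<in> ring_iso R R"
      by (auto simp: ring_iso_def ring_hom_def compose_def o_def cong: bij_betw_cong)
    then have "compose (carrier R) \<phi> \<psi> \<in> ?C"
      using \<phi>\<psi> K by (auto simp: galois_group_carrier compose_def)
    then show "\<phi> \<otimes>\<^bsub>BijGroup (carrier R)\<^esub> \<psi> \<in> ?C"
      using \<phi>\<psi>[THEN galois_group_Bij] by (simp add: BijGroup_def)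
  qed
  then show ?thesis
    using subgroup.subgroup_is_group[OF _ group_BijGroup] by (simp add: galois_group_def)
qed

text \<open>Coefficients in \<open>R'\<close> lie in \<open>K\<close> and are fixed, so roots go to
  roots of the same monic polynomial.\<close>

lemma (in domain) galois_group_integral_closure:
  assumes R': "subring R' R" "R' \<subseteq> K" and \<phi>: "\<phi> \<in> carrier (galois_group R K)"
    and x: "x \<in> integral_closure R R'"
  shows "\<phi> x \<in> integral_closure R R'"
proof -
  have "\<phi> \<in> ring_hom R R" using \<phi> by (simp add: galois_group_carrier ring_iso_def)
  then interpret \<phi>: ring_hom_ring R R \<phi> using ring_axioms ring_hom_ringI2 by blast
  obtain p where p: "p \<in> carrier (R'[X])" "p \<noteq> []" "hd p = \<one>" "eval p x = \<zero>"
    and xc: "x \<in> carrier R"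
    using x unfolding integral_closure_def by blast
  then have "set p \<subseteq> R'" by (auto simp: polynomial_def simp flip: univ_poly_carrier)
  then have "map \<phi> p = p" using R'(2) \<phi> by (auto simp: galois_group_carrier intro: map_idI)
  then have "eval p (\<phi> x) = \<zero>" using \<phi>.eval_hom[OF R'(1) xc p(1)] p(4) by simp
  then show ?thesis using p xc unfolding integral_closure_def by auto
qed

section \<open>Transfer of separatedness from the base ring to the integral closure\<close>

text \<open>
  The elements of \<open>R'\<close> that lie in every \<open>p\<^sup>n S\<close> form an ideal of \<open>R'\<close>, generated by \<open>d\<close> say.
  As \<open>d\<close> is divisible by \<open>p\<close>, also \<open>d/p\<close> belongs to this ideal, which forces \<open>d = 0\<close>.
\<close>

lemma (in domain) dvr_separated_in_extension:
  assumes R': "subring R' R" and S: "subring S R" and RS: "R' \<subseteq> S"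
    and dvr: "discrete_valuation_ring (R\<lparr>carrier := R'\<rparr>)"
    and p: "p \<in> R'" "max_ideal (R\<lparr>carrier := R'\<rparr>) = PIdl\<^bsub>R\<lparr>carrier := R'\<rparr>\<^esub> p" "p \<noteq> \<zero>"
    and pS: "\<And>s. s \<in> S \<Longrightarrow> s \<otimes> p \<noteq> \<one>"
    and a: "a \<in> R'" "\<And>n::nat. \<exists>s\<in>S. a = s \<otimes> p [^] n"
  shows "a = \<zero>"
proof -
  let ?B = "R\<lparr>carrier := R'\<rparr>"
  interpret B: principal_domain ?B using dvr unfolding discrete_valuation_ring_def by simp
  note RE = subringE[OF R'] and SE = subringE[OF S]
  have Sc: "s \<in> carrier R" if "s \<in> S" for s using that SE(1) by auto
  have pc: "p \<in> carrier R" using p(1) RE(1) by auto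
  define J where "J = {b \<in> R'. \<forall>n::nat. \<exists>s\<in>S. b = s \<otimes> p [^] n}"
  have Jc: "b \<in> carrier R" if "b \<in> J" for b using that RE(1) unfolding J_def by auto
  have "ideal J ?B"
  proof (rule idealI[OF B.ring_axioms])
    show "subgroup J (add_monoid ?B)"
    proof (rule group.subgroupI[OF B.a_group])
      show "J \<subseteq> carrier (add_monoid ?B)" by (auto simp: J_def)
      show "J \<noteq> {}" using a unfolding J_def by auto
    next
      fix b assume b: "b \<in> J"
      have "\<ominus> b \<in> J" unfolding J_def
      proof (intro CollectI conjI allI)
        show "\<ominus> b \<in> R'" using b RE(5) by (simp add: J_def)
        fix n :: nat
        obtain s where s: "s \<in> S" "b = s \<otimes> p [^] n" using b unfolding J_def by blast
        then show "\<exists>s\<in>S. \<ominus> b = s \<otimes> p [^] n"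
          using SE(5) Sc pc by (auto intro!: bexI[of _ "\<ominus> s"] simp: l_minus)
      qed
      \<comment> \<open>The inverse in the additive monoid of \<open>?B\<close> has to be matched
        with negation in the ambient ring.\<close>
      moreover have "inv\<^bsub>add_monoid ?B\<^esub> b = \<ominus> b"
        using b Jc R' a_inv_def RE by (intro group.inv_equality[OF B.a_group]) (auto simp: J_def l_neg)
      ultimately show "inv\<^bsub>add_monoid ?B\<^esub> b \<in> J" by simp
    next
      fix b b' assume b: "b \<in> J" "b' \<in> J"
      have "b \<oplus> b' \<in> J" unfolding J_def
      proof (intro CollectI conjI allI)
        show "b \<oplus> b' \<in> R'" using b RE(7) by (simp add: J_def)
        fix n :: nat
        obtain s s' where s: "s \<in> S" "b = s \<otimes> p [^] n" "s' \<in> S" "b' = s' \<otimes> p [^] n"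
          using b unfolding J_def by blast
        then have "b \<oplus> b' = (s \<oplus> s') \<otimes> p [^] n" using Sc pc by (simp add: l_distr)
        then show "\<exists>t\<in>S. b \<oplus> b' = t \<otimes> p [^] n" using SE(7) s by blast
      qed
      then show "b \<otimes>\<^bsub>add_monoid ?B\<^esub> b' \<in> J" by simp
    qed
    fix b x assume b: "b \<in> J" and x: "x \<in> carrier ?B"
    have xS: "x \<in> S" using x RS by auto
    have "x \<otimes> b \<in> J" unfolding J_def
    proof (intro CollectI conjI allI)
      show "x \<otimes> b \<in> R'" using b x RE(6) by (simp add: J_def)
      fix n :: nat
      obtain s where s: "s \<in> S" "b = s \<otimes> p [^] n" using b unfolding J_def by blast
      then have "x \<otimes> b = (x \<otimes> s) \<otimes> p [^] n" using Sc pc xS by (simp add: m_assoc)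
      then show "\<exists>t\<in>S. x \<otimes> b = t \<otimes> p [^] n" using SE(6) s xS by blast
    qed
    then show "x \<otimes>\<^bsub>?B\<^esub> b \<in> J" "b \<otimes>\<^bsub>?B\<^esub> x \<in> J"
      using m_comm[OF Jc[OF b] Sc[OF xS]] by simp_all
  qed
  then obtain d where d: "d \<in> R'" "J = PIdl\<^bsub>?B\<^esub> d" using B.exists_gen by auto
  have dJ: "d \<in> J" using B.cgenideal_self d by simp
  have dc: "d \<in> carrier R" using Jc[OF dJ] .
  \<comment> \<open>In \<open>S\<close> the element \<open>d\<close> is a multiple of
    \<open>p\<close>, so a unit \<open>d\<close> would make \<open>p\<close> invertible
    there.\<close>
  have "d \<notin> Units ?B"
  proof
    assume "d \<in> Units ?B"
    then obtain e where e: "e \<in> R'" "e \<otimes> d = \<one>" unfolding Units_def by auto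
    obtain s where s: "s \<in> S" "d = s \<otimes> p [^] (1::nat)" using dJ unfolding J_def by blast
    have "(e \<otimes> s) \<otimes> p = \<one>" using e s pc Sc RS by (auto simp: m_assoc subsetD)
    then show False using pS[of "e \<otimes> s"] SE(6) e s RS by blast
  qed
  then have "d \<in> max_ideal ?B"
    using B.nonunit_in_maximalideal[of d] discrete_valuation_ring_maximalideal(1)[OF dvr] d by auto
  then obtain e where e: "e \<in> R'" "d = e \<otimes> p" unfolding p(2) cgenideal_def by auto
  have ec: "e \<in> carrier R" using e RE(1) by auto
  have "e \<in> J" unfolding J_def
  proof (intro CollectI conjI allI)
    show "e \<in> R'" by (rule e)
    fix n :: nat
    \<comment> \<open>One extra power of \<open>p\<close> is taken for \<open>d\<close>, so that
      \<open>n\<close> of them are left for \<open>e\<close> after cancelling.\<close>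
    obtain s where s: "s \<in> S" "d = s \<otimes> p [^] Suc n" using dJ unfolding J_def by blast
    then have "e \<otimes> p = (s \<otimes> p [^] n) \<otimes> p" using e pc Sc by (simp add: m_assoc)
    then have "e = s \<otimes> p [^] n" using m_rcancel[OF p(3) pc] ec s Sc pc by simp
    then show "\<exists>s\<in>S. e = s \<otimes> p [^] n" using s by blast
  qed
  then obtain g where g: "g \<in> R'" "e = g \<otimes> d" unfolding d(2) cgenideal_def by auto
  have gc: "g \<in> carrier R" using g RE(1) by auto
  \<comment> \<open>\<open>d = e \<otimes> p\<close> and \<open>e = g \<otimes> d\<close> combine to
    \<open>d = (g \<otimes> p) \<otimes> d\<close>, so a nonzero \<open>d\<close> would make
    \<open>p\<close> invertible in \<open>S\<close>.\<close>
  have "d = \<zero>"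
  proof (rule ccontr)
    assume "d \<noteq> \<zero>"
    have "\<one> \<otimes> d = (g \<otimes> p) \<otimes> d" using e(2) g gc dc pc by (simp add: m_ac)
    then have "g \<otimes> p = \<one>" using m_rcancel[OF \<open>d \<noteq> \<zero>\<close> dc one_closed] gc pc by simp
    then show False using pS g RS by blast
  qed
  moreover have "a \<in> J" using a unfolding J_def by auto
  ultimately show ?thesis unfolding d(2) cgenideal_def using RE(1) by auto
qed

text \<open>The main point is separatedness: a nonzero element divisible by all powers of \<pi>
  would have a nonzero multiple in \<open>R'\<close> divisible by all powers of \<open>p\<close>,
  against \<open>dvr_separated_in_extension\<close>.\<close>

lemma (in domain) integral_closure_uniformized_domain:
  assumes dvr: "discrete_valuation_ring (R\<lparr>carrier := R'\<rparr>)" and R': "subring R' R"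
    and A: "A = R\<lparr>carrier := integral_closure R R'\<rparr>"
    and unram: "Idl\<^bsub>A\<^esub> (max_ideal (R\<lparr>carrier := R'\<rparr>)) = max_ideal A"
    and \<pi>: "\<pi> \<in> carrier A" and max: "\<And>M. maximalideal M A \<longleftrightarrow> M = PIdl\<^bsub>A\<^esub> \<pi>"
  shows "uniformized_domain A \<pi>"
proof -
  let ?S = "integral_closure R R'" and ?B = "R\<lparr>carrier := R'\<rparr>"
  have M: "maximalideal (PIdl\<^bsub>A\<^esub> \<pi>) A" using max by simp
  \<comment> \<open>\<open>maximalideal\<close> carries the ring axioms of \<open>A\<close>, so
    \<open>max\<close> also supplies that the integral closure is a subring.\<close>
  then have "ring A" by (intro ideal.axioms(2) maximalideal.axioms(1))
  moreover have "?S \<subseteq> carrier R" unfolding integral_closure_def by auto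
  ultimately have S: "subring ?S R" using ring_incl_imp_subring unfolding A by simp
  note RS = integral_closure_subset[OF R'] and SE = subringE[OF S]
  interpret A: domain A using subring_is_domain[OF S] unfolding A .
  interpret M: maximalideal "PIdl\<^bsub>A\<^esub> \<pi>" A by (rule M)
  interpret B: principal_domain ?B using dvr unfolding discrete_valuation_ring_def by simp
  have Sc: "s \<in> carrier R" if "s \<in> ?S" for s using that SE(1) by auto
  have pow: "x [^]\<^bsub>A\<^esub> n = x [^] n" for x and n :: nat
    unfolding A by (rule nat_pow_consistent[symmetric])
  have \<pi>S: "\<pi> \<in> ?S" using \<pi> unfolding A by simp
  have maxA: "max_ideal A = PIdl\<^bsub>A\<^esub> \<pi>" unfolding max_ideal_def max by simp
  have "maximalideal (max_ideal ?B) ?B" using discrete_valuation_ring_maximalideal(1)[OF dvr] by simp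
  then have "ideal (max_ideal ?B) ?B" by (rule maximalideal.axioms)
  then obtain p where p: "p \<in> R'" "max_ideal ?B = PIdl\<^bsub>?B\<^esub> p" using B.exists_gen by auto
  have pA: "p \<in> carrier A" using p(1) RS by (auto simp: A)
  have pc: "p \<in> carrier R" using p(1) RS Sc by auto
  have p0: "p \<noteq> \<zero>"
  proof
    assume "p = \<zero>"
    then have "max_ideal ?B = {\<zero>}" unfolding p(2) cgenideal_def using subringE[OF R'] by force
    then show False using discrete_valuation_ring_maximalideal(2)[OF dvr] by simp
  qed
  \<comment> \<open>Extending the ideal of \<open>p\<close> to \<open>A\<close> yields the principal
    ideal of \<open>p\<close>; ramification index 1 then makes \<open>p\<close> and \<pi> generate
    the same ideal.\<close>
  have "Idl\<^bsub>A\<^esub> (PIdl\<^bsub>?B\<^esub> p) = PIdl\<^bsub>A\<^esub> p"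
  proof
    have "PIdl\<^bsub>?B\<^esub> p \<subseteq> PIdl\<^bsub>A\<^esub> p" using RS by (auto simp: cgenideal_def A)
    then show "Idl\<^bsub>A\<^esub> (PIdl\<^bsub>?B\<^esub> p) \<subseteq> PIdl\<^bsub>A\<^esub> p"
      using A.genideal_minimal[OF A.cgenideal_ideal[OF pA]] by simp
    have sub: "PIdl\<^bsub>?B\<^esub> p \<subseteq> carrier A" using RS subringE(6)[OF R'] p by (auto simp: cgenideal_def A)
    show "PIdl\<^bsub>A\<^esub> p \<subseteq> Idl\<^bsub>A\<^esub> (PIdl\<^bsub>?B\<^esub> p)"
      using A.genideal_self[OF sub] B.cgenideal_self[of p] p(1)
      by (intro A.cgenideal_minimal A.genideal_ideal sub) auto
  qed
  then have eq: "PIdl\<^bsub>A\<^esub> p = PIdl\<^bsub>A\<^esub> \<pi>" using unram unfolding p(2) maxA by simp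
  then have "\<pi> \<in> PIdl\<^bsub>A\<^esub> p" "p \<in> PIdl\<^bsub>A\<^esub> \<pi>"
    using A.cgenideal_self[OF \<pi>] A.cgenideal_self[OF pA] by simp_all
  then obtain t w where t: "t \<in> ?S" "\<pi> = t \<otimes> p" and w: "w \<in> ?S" "p = w \<otimes> \<pi>"
    unfolding cgenideal_def A by auto
  have \<pi>0: "\<pi> \<noteq> \<zero>" using w p0 Sc by auto
  have pS: "s \<otimes> p \<noteq> \<one>" if "s \<in> ?S" for s
  proof
    assume "s \<otimes> p = \<one>"
    then have "\<one>\<^bsub>A\<^esub> \<in> PIdl\<^bsub>A\<^esub> p" using that unfolding cgenideal_def A by force
    then show False using M.one_imp_carrier M.I_notcarr eq by simp
  qed
  have sep: "x = \<zero>\<^bsub>A\<^esub>" if x: "x \<in> carrier A" and x_pow: "\<And>n::nat. x \<in> PIdl\<^bsub>A\<^esub> (\<pi> [^]\<^bsub>A\<^esub> n)" for x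
  proof (rule ccontr)
    assume "x \<noteq> \<zero>\<^bsub>A\<^esub>"
    then obtain a s where a: "a \<in> R'" "a \<noteq> \<zero>" and s: "s \<in> ?S" "a = s \<otimes> x"
      using integral_closure_dvd[OF R' S, of x] x unfolding A by auto
    have "\<exists>s\<in>?S. a = s \<otimes> p [^] n" for n :: nat
    proof -
      obtain y where y: "y \<in> ?S" "x = y \<otimes> \<pi> [^] n"
        using x_pow[of n] unfolding cgenideal_def pow unfolding A by auto
      have tn: "t [^] n \<in> ?S" by (induction n) (use SE t in auto)
      \<comment> \<open>Substitute \<open>t \<otimes> p\<close> for \<pi> in the factorization of
        \<open>x\<close>.\<close>
      have "a = (s \<otimes> y \<otimes> t [^] n) \<otimes> p [^] n"
        using s y t Sc pc by (simp add: nat_pow_distrib m_assoc)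
      then show ?thesis using s y tn SE(6) by blast
    qed
    then show False using dvr_separated_in_extension[OF R' S RS dvr p p0 pS a(1)] a(2) by blast
  qed
  show ?thesis
  proof (rule A.uniformized_domainI)
    show "\<pi> \<in> carrier A" by (rule \<pi>)
    show "\<pi> \<noteq> \<zero>\<^bsub>A\<^esub>" using \<pi>0 unfolding A by simp
    show "maximalideal M A \<longleftrightarrow> M = PIdl\<^bsub>A\<^esub> \<pi>" for M by (rule max)
    show "x = \<zero>\<^bsub>A\<^esub>" if "x \<in> carrier A" "\<And>n::nat. x \<in> PIdl\<^bsub>A\<^esub> (\<pi> [^]\<^bsub>A\<^esub> n)" for x
      using that by (rule sep)
  qed
qed

text \<open>Automorphisms preserve the integral closure and so restrict to endomorphisms of
  \<open>A\<close>; on \<open>A\<close> the extensional identity and composites agree with the plain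
  ones.\<close>

lemma (in domain) galois_group_uniformized_action:
  assumes K: "K \<subseteq> carrier R" and R': "subring R' R" "R' \<subseteq> K"
    and A: "A = R\<lparr>carrier := integral_closure R R'\<rparr>" and \<pi>: "uniformized_domain A \<pi>"
  shows "uniformized_action A \<pi> (galois_group R K)"
proof -
  interpret A: uniformized_domain A \<pi> by (rule \<pi>)
  interpret G: group "galois_group R K" by (rule galois_group_is_group[OF K])
  have SR: "integral_closure R R' \<subseteq> carrier R" unfolding integral_closure_def by auto
  show ?thesis
  proof unfold_locales
    fix \<phi> assume \<phi>: "\<phi> \<in> carrier (galois_group R K)"
    have "\<phi> \<in> ring_hom R R" using \<phi> by (simp add: galois_group_carrier ring_iso_def)
    then show "\<phi> \<in> ring_hom A A"
      using galois_group_integral_closure[OF R' \<phi>] SR by (auto simp: A ring_hom_def subset_iff)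
  next
    fix x assume "x \<in> carrier A"
    then show "\<one>\<^bsub>galois_group R K\<^esub> x = x"
      using SR by (auto simp: A galois_group_def BijGroup_def)
  next
    fix \<phi> \<psi> x
    assume "\<phi> \<in> carrier (galois_group R K)" "\<psi> \<in> carrier (galois_group R K)" "x \<in> carrier A"
    then show "(\<phi> \<otimes>\<^bsub>galois_group R K\<^esub> \<psi>) x = \<phi> (\<psi> x)"
      using SR by (auto simp: galois_group_mult compose_def A)
  qed
qed

theorem proposition4p3:
  fixes L :: "('a, 'b) ring_scheme" and K R S :: "'a set" and \<pi> :: 'a
    and A :: "('a, 'b) ring_scheme" and G :: "('a \<Rightarrow> 'a) monoid"
    and f c h :: "('a \<Rightarrow> 'a) \<Rightarrow> ('a \<Rightarrow> 'a) \<Rightarrow> 'a" and u :: "('a \<Rightarrow> 'a) \<Rightarrow> 'a"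
    and r\<^sub>f :: "('a \<Rightarrow> 'a) \<Rightarrow> nat"
  assumes "field L"
    and "quotient_field L R K"
    and "complete_dvr (L\<lparr>carrier := R\<rparr>)"
    and "finite (carrier (residue_field (L\<lparr>carrier := R\<rparr>)))"
    and "finite_galois L K"
    and G: "G = galois_group L K"
    and "S = integral_closure L R"
    and A: "A = L\<lparr>carrier := S\<rparr>"
    and "unramified (L\<lparr>carrier := R\<rparr>) A"
    and "\<pi> \<in> S"
    and "\<And>M. maximalideal M A \<longleftrightarrow> M = PIdl\<^bsub>A\<^esub> \<pi>"
    and u: "u = unif_unit A \<pi>"
    and f: "f \<in> weak_cocycles G A"
    and r\<^sub>f: "r\<^sub>f = (\<lambda>\<sigma>. adic_val A (PIdl\<^bsub>A\<^esub> \<pi>) (f \<sigma> (inv\<^bsub>G\<^esub> \<sigma>)))"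
    and c: "c = (\<lambda>\<sigma> \<tau>. unit_part A \<pi> (f \<sigma> \<tau>))"
    and h: "h = (\<lambda>\<sigma> \<tau>. inv\<^bsub>A\<^esub> (c \<sigma> \<tau> \<otimes>\<^bsub>A\<^esub> c (inv\<^bsub>G\<^esub> \<tau>) (inv\<^bsub>G\<^esub> \<sigma>))
                  \<otimes>\<^bsub>A\<^esub> u \<sigma> [^]\<^bsub>A\<^esub> r\<^sub>f \<tau> \<otimes>\<^bsub>A\<^esub> f (inv\<^bsub>G\<^esub> \<tau>) (inv\<^bsub>G\<^esub> \<sigma>))"
  shows "r\<^sub>f \<in> Sl G \<and> h \<in> weak_cocycles G A \<and>
    (\<forall>\<sigma>\<in>carrier G. \<forall>\<tau>\<in>carrier G. f \<sigma> \<tau> \<otimes>\<^bsub>A\<^esub> h \<sigma> \<tau> = b_cocycle G A \<pi> r\<^sub>f \<sigma> \<tau>)"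
proof -
  interpret field L by (rule assms(1))
  have R: "subring R L" and K: "subfield K L"
    and K_eq: "K = {a \<otimes>\<^bsub>L\<^esub> inv\<^bsub>L\<^esub> b | a b. a \<in> R \<and> b \<in> R - {\<zero>\<^bsub>L\<^esub>}}"
    using assms(2) unfolding quotient_field_def by auto
  \<comment> \<open>Elements of \<open>R\<close> are fractions with denominator
    \<open>\<one>\<close>.\<close>
  have "a \<in> K" if "a \<in> R" for a
    unfolding K_eq using that subringE[OF R]
    by (intro CollectI exI[of _ a] exI[of _ "\<one>\<^bsub>L\<^esub>"]) auto
  then have RK: "R \<subseteq> K" by blast
  have KL: "K \<subseteq> carrier L" using subfieldE(3)[OF K] .
  have dvr: "discrete_valuation_ring (L\<lparr>carrier := R\<rparr>)"
    using assms(3) unfolding complete_dvr_def by blast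
  have A': "A = L\<lparr>carrier := integral_closure L R\<rparr>" using A assms(7) by simp
  have "Idl\<^bsub>A\<^esub> (max_ideal (L\<lparr>carrier := R\<rparr>)) = max_ideal A"
    using assms(9) unfolding unramified_def by blast
  moreover have "\<pi> \<in> carrier A" using assms(10) A by simp
  ultimately have "uniformized_domain A \<pi>"
    using integral_closure_uniformized_domain[OF dvr R A'] assms(11) by blast
  then interpret A: uniformized_action A \<pi> G
    unfolding G using galois_group_uniformized_action[OF KL R RK A'] by blast
  show ?thesis
    using A.val_cocycle_Sl[OF f r\<^sub>f] A.cocycle_complement[OF f r\<^sub>f c h[unfolded u]] by blast
qed

end
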